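(* For every complete multipartite graph $H$ (connected, with at least three nodes, of constant size) that is neither a clique nor a star, the one-round bandwidth complexity of $\textsc{MemDetect}(H)$ under edge insertions is $\Omega(n)$.
   Context: A graph is complete multipartite if its node set can be partitioned into independent sets such that two nodes are adjacent iff they lie in different parts; a star is $K_{1,s}$. Dynamic network model: a sequence of graphs $G^0, G^1, \ldots$ on $n$ nodes, each obtained from the previous by at most one edge insertion; nodes have distinct IDs from $[n]$, know their neighbors' IDs and initially the whole of $G^0$; communication is synchronous, each round the change happens first, then each node sends a $B$-bit message to each neighbor; nodes detect changes only via their neighbor lists; algorithms are deterministic. A one-round algorithm must output correctly for the current graph at the end of each round (after that round's change and communication). The one-round bandwidth complexity is the minimum such $B$. $\textsc{MemDetect}(H)$: each node $v$ outputs whether $v$ belongs to some subgraph of the current graph isomorphic to $H$. *)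

theory Defs
  imports "HOL-Library.Extended_Real" "HOL-Library.Disjoint_Sets"
begin

section \<open>Simple graphs\<close>

datatype 'a ugraph = UGraph (verts: "'a set") (edges: "'a set set")

definition simple_graph :: "'a ugraph \<Rightarrow> bool" where
  "simple_graph G \<longleftrightarrow> (\<forall>e\<in>edges G. e \<subseteq> verts G \<and> card e = 2)"

definition adj :: "'a ugraph \<Rightarrow> 'a \<Rightarrow> 'a \<Rightarrow> bool" where
  "adj G u v \<longleftrightarrow> {u, v} \<in> edges G"

definition nbrs :: "'a ugraph \<Rightarrow> 'a \<Rightarrow> 'a set" where
  "nbrs G v = {u. adj G u v}"

text \<open>Subgraphs need not be induced.\<close>

definition subgraph :: "'a ugraph \<Rightarrow> 'a ugraph \<Rightarrow> bool" where
  "subgraph S G \<longleftrightarrow> simple_graph S \<and> verts S \<subseteq> verts G \<and> edges S \<subseteq> edges G"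

definition isomorphic :: "'a ugraph \<Rightarrow> 'b ugraph \<Rightarrow> bool" where
  "isomorphic G H \<longleftrightarrow>
     (\<exists>f. bij_betw f (verts G) (verts H) \<and>
          (\<forall>u\<in>verts G. \<forall>v\<in>verts G. adj G u v \<longleftrightarrow> adj H (f u) (f v)))"

definition connected_graph :: "'a ugraph \<Rightarrow> bool" where
  "connected_graph G \<longleftrightarrow> (\<forall>u\<in>verts G. \<forall>v\<in>verts G. (adj G)\<^sup>*\<^sup>* u v)"

definition independent_set :: "'a ugraph \<Rightarrow> 'a set \<Rightarrow> bool" where
  "independent_set G p \<longleftrightarrow> p \<subseteq> verts G \<and> (\<forall>u\<in>p. \<forall>v\<in>p. \<not> adj G u v)"

definition complete_multipartite :: "'a ugraph \<Rightarrow> bool" where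
  "complete_multipartite G \<longleftrightarrow>
     (\<exists>P. partition_on (verts G) P \<and> (\<forall>p\<in>P. independent_set G p) \<and>
          (\<forall>p\<in>P. \<forall>q\<in>P. \<forall>u\<in>p. \<forall>v\<in>q. adj G u v \<longleftrightarrow> p \<noteq> q))"

definition is_clique :: "'a ugraph \<Rightarrow> bool" where
  "is_clique G \<longleftrightarrow> (\<forall>u\<in>verts G. \<forall>v\<in>verts G. u \<noteq> v \<longrightarrow> adj G u v)"

definition is_star :: "'a ugraph \<Rightarrow> bool" where
  "is_star G \<longleftrightarrow> (\<exists>c\<in>verts G. edges G = {{c, v} | v. v \<in> verts G - {c}})"


section \<open>Dynamic networks under edge insertions\<close>

text \<open>The initial graph is arbitrary; round \<open>t \<ge> 1\<close> starts with the change from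
  \<open>G (t - 1)\<close> to \<open>G t\<close>.\<close>

definition insertion_step :: "'a ugraph \<Rightarrow> 'a ugraph \<Rightarrow> bool" where
  "insertion_step G G' \<longleftrightarrow>
     G' = G \<or>
     (\<exists>u\<in>verts G. \<exists>v\<in>verts G. u \<noteq> v \<and> \<not> adj G u v \<and>
        G' = UGraph (verts G) (insert {u, v} (edges G)))"

definition insertion_network :: "nat \<Rightarrow> (nat \<Rightarrow> nat ugraph) \<Rightarrow> bool" where
  "insertion_network n G \<longleftrightarrow>
     verts (G 0) = {1..n} \<and> simple_graph (G 0) \<and> (\<forall>t. insertion_step (G t) (G (Suc t)))"

text \<open>Local memory and computation are unbounded, so the state of a node is taken to be everything
  it has observed: its ID, the initial graph, and for every completed round the map from the
  neighbors in that round (the domain of the map) to the messages received from them.\<close>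

type_synonym message = "bool list"
type_synonym observation = "nat \<rightharpoonup> message"

text \<open>\<open>send A v G0 h N u\<close> is the message that node \<open>v\<close> with history \<open>h\<close> of completed rounds and current
  neighbor list \<open>N\<close> sends to \<open>u\<close>; \<open>outp A v G0 h\<close> is the output of \<open>v\<close> at the end of the last round
  of \<open>h\<close>. For fixed arguments both are determined, i.e. algorithms are deterministic.\<close>

datatype algorithm = Algorithm
  (send: "nat \<Rightarrow> nat ugraph \<Rightarrow> observation list \<Rightarrow> nat set \<Rightarrow> nat \<Rightarrow> message")
  (outp: "nat \<Rightarrow> nat ugraph \<Rightarrow> observation list \<Rightarrow> bool")

definition has_bandwidth :: "nat \<Rightarrow> algorithm \<Rightarrow> bool" where
  "has_bandwidth B A \<longleftrightarrow> (\<forall>v G0 h N u. length (send A v G0 h N u) = B)"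

text \<open>The observations of node \<open>v\<close> in rounds \<open>1, \<dots>, t\<close>. All messages of a round are sent
  simultaneously, after the change of that round.\<close>

primrec history :: "algorithm \<Rightarrow> (nat \<Rightarrow> nat ugraph) \<Rightarrow> nat \<Rightarrow> nat \<Rightarrow> observation list" where
  "history A G 0 = (\<lambda>v. [])"
| "history A G (Suc t) = (\<lambda>v. history A G t v @
     [\<lambda>u. if u \<in> nbrs (G (Suc t)) v
          then Some (send A u (G 0) (history A G t u) (nbrs (G (Suc t)) u) v)
          else None])"

text \<open>A problem prescribes the output of every node in the current graph.\<close>

type_synonym problem = "nat ugraph \<Rightarrow> nat \<Rightarrow> bool"

definition one_round_solves :: "nat \<Rightarrow> problem \<Rightarrow> algorithm \<Rightarrow> bool" where
  "one_round_solves n P A \<longleftrightarrow>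
     (\<forall>G. insertion_network n G \<longrightarrow>
        (\<forall>t\<ge>1. \<forall>v\<in>{1..n}. outp A v (G 0) (history A G t v) \<longleftrightarrow> P (G t) v))"

text \<open>The value is \<open>\<infinity>\<close> if no bandwidth suffices; otherwise the infimum is attained.
  The algorithm may depend on \<open>n\<close>.\<close>

definition one_round_bandwidth :: "problem \<Rightarrow> nat \<Rightarrow> enat" where
  "one_round_bandwidth P n = Inf {enat B | B. \<exists>A. has_bandwidth B A \<and> one_round_solves n P A}"

definition MemDetect :: "'a ugraph \<Rightarrow> problem" where
  "MemDetect H G v \<longleftrightarrow> (\<exists>S. subgraph S G \<and> isomorphic S H \<and> v \<in> verts S)"

text \<open>\<open>f \<in> \<Omega>(g)\<close> for possibly infinite \<open>f\<close> (the Landau symbols of the library need a normed field).\<close>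

definition enat_bigomega :: "(nat \<Rightarrow> enat) \<Rightarrow> (nat \<Rightarrow> real) \<Rightarrow> bool" where
  "enat_bigomega f g \<longleftrightarrow>
     (\<exists>c>0. \<forall>\<^sub>F n in sequentially. ereal (c * \<bar>g n\<bar>) \<le> ereal_of_enat (f n))"

end

theory Submission
  imports Defs "HOL-Library.FuncSet"
begin

text \<open>Let \<open>v\<close> be a vertex of minimum degree in \<open>H\<close>, i.e. one in a largest part, \<open>b\<close> another vertex of
  that part, and \<open>a, c\<close> two neighbors of \<open>v\<close>. Replace \<open>b\<close> by a set \<open>X\<close> of \<open>n - |H| + 1\<close> copies of which
  exactly those in a set \<open>S\<close> are adjacent to \<open>c\<close> and only one, \<open>x\<close>, is adjacent to \<open>a\<close>. Since \<open>v\<close> has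
  minimum degree, a copy of \<open>H\<close> through \<open>v\<close> uses all neighbors of \<open>v\<close>, and the remaining vertices of
  the copy are common neighbors of these; so \<open>v\<close> lies in a copy of \<open>H\<close> iff \<open>x \<in> S\<close>. If the edges
  between \<open>c\<close> and \<open>S\<close> are inserted first, then the \<open>O(|H|)\<close> edges that join \<open>a\<close> and \<open>v\<close> to the rest,
  and finally \<open>ax\<close>, then \<open>v\<close> has to answer for an arbitrary \<open>x\<close> although \<open>a\<close> and \<open>v\<close> have received only
  \<open>O(|H|\<^sup>2 B)\<close> bits that depend on \<open>S\<close>. Hence \<open>2 ^ |X| \<le> 2 ^ O(|H|\<^sup>2 B)\<close>.\<close>

section \<open>Copies of \<open>H\<close> as injective homomorphisms; structure of complete
  multipartite graphs\<close>

section \<open>Graphs\<close>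

lemma adj_commute: "adj G u v \<longleftrightarrow> adj G v u"
  by (simp add: adj_def insert_commute)

lemma adj_UGraph: "adj (UGraph V E) u v \<longleftrightarrow> {u, v} \<in> E"
  by (simp add: adj_def)

lemma simple_graph_adjD:
  assumes "simple_graph G" "adj G u v"
  shows "u \<in> verts G" "v \<in> verts G" "u \<noteq> v"
  using assms by (fastforce simp: simple_graph_def adj_def)+

text \<open>Since subgraphs need not be induced, a copy of \<open>H\<close> is the same as an
  injective homomorphism: the inverse of an isomorphism is one, and conversely the image of
  \<open>H\<close> under \<open>g\<close>, with only the image edges, is the subgraph.\<close>

lemma MemDetect_iff:
  assumes H: "simple_graph H"
  shows "MemDetect H G v \<longleftrightarrow>
    (\<exists>g. inj_on g (verts H) \<and> g ` verts H \<subseteq> verts G \<and>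
         (\<forall>u w. adj H u w \<longrightarrow> adj G (g u) (g w)) \<and> v \<in> g ` verts H)"
    (is "_ \<longleftrightarrow> ?R")
proof
  assume "MemDetect H G v"
  then obtain S f where S: "subgraph S G" "v \<in> verts S"
    and f: "bij_betw f (verts S) (verts H)"
    and adj: "\<forall>u\<in>verts S. \<forall>v\<in>verts S. adj S u v \<longleftrightarrow> adj H (f u) (f v)"
    by (auto simp: MemDetect_def isomorphic_def)
  let ?g = "inv_into (verts S) f"
  have g: "bij_betw ?g (verts H) (verts S)"
    using f by (rule bij_betw_inv_into)
  have "adj G (?g u) (?g w)" if uw: "adj H u w" for u w
  proof -
    have "u \<in> verts H" "w \<in> verts H"
      using simple_graph_adjD[OF H uw] by auto
    then have "?g u \<in> verts S" "?g w \<in> verts S" "f (?g u) = u" "f (?g w) = w"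
      using bij_betwE[OF g] bij_betw_inv_into_right[OF f] by blast+
    then have "adj S (?g u) (?g w)"
      using uw adj by metis
    then show ?thesis
      using S(1) by (auto simp: subgraph_def adj_def)
  qed
  moreover have "?g ` verts H = verts S" "inj_on ?g (verts H)"
    using g by (simp_all add: bij_betw_def)
  moreover have "verts S \<subseteq> verts G"
    using S(1) by (simp add: subgraph_def)
  ultimately show ?R
    using S(2) by metis
next
  assume ?R
  then obtain g where inj: "inj_on g (verts H)" and sub: "g ` verts H \<subseteq> verts G"
    and hom: "\<And>u w. adj H u w \<Longrightarrow> adj G (g u) (g w)" and v: "v \<in> g ` verts H"
    by blast
  define S where "S = UGraph (g ` verts H) ((`) g ` edges H)"
  have edge: "e \<subseteq> verts H \<and> card e = 2" if "e \<in> edges H" for e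
    using H that by (auto simp: simple_graph_def)
  have "simple_graph S"
    unfolding simple_graph_def S_def
    using edge by (auto simp: card_image inj_on_subset[OF inj])
  moreover have "g ` e \<in> edges G" if e: "e \<in> edges H" for e
  proof -
    obtain u w where "e = {u, w}"
      using edge[OF e] by (auto simp: card_2_iff)
    then show ?thesis
      using hom[of u w] e by (simp add: adj_def)
  qed
  ultimately have "subgraph S G"
    using sub by (auto simp: subgraph_def S_def)
  moreover have "isomorphic S H"
  proof -
    let ?f = "inv_into (verts H) g"
    have bij: "bij_betw g (verts H) (verts S)"
      using inj by (simp add: S_def bij_betw_def)
    have "adj S (g u) (g w) \<longleftrightarrow> adj H u w" if uw: "u \<in> verts H" "w \<in> verts H" for u w
    proof
      assume "adj S (g u) (g w)"
      then obtain e where e: "e \<in> edges H" "g ` {u, w} = g ` e"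
        by (auto simp: adj_def S_def)
      then have "{u, w} = e"
        using inj_on_image_eq_iff[OF inj, of "{u, w}" e] edge uw by auto
      then show "adj H u w"
        using e by (simp add: adj_def)
    next
      assume "adj H u w"
      then have "g ` {u, w} \<in> edges S"
        unfolding adj_def S_def ugraph.sel by (rule imageI)
      then show "adj S (g u) (g w)"
        by (simp add: adj_def)
    qed
    then have "\<forall>u\<in>verts S. \<forall>w\<in>verts S. adj S u w \<longleftrightarrow> adj H (?f u) (?f w)"
      using inj by (simp add: S_def)
    with bij_betw_inv_into[OF bij] show ?thesis
      unfolding isomorphic_def by blast
  qed
  ultimately show "MemDetect H G v"
    using v unfolding MemDetect_def by (metis S_def ugraph.sel(1))
qed

text \<open>Nonadjacent vertices lie in the same part, and the neighborhood of a vertex is the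
  complement of its part.\<close>

lemma complete_multipartite_twins:
  assumes "complete_multipartite H" "simple_graph H" "u \<in> verts H" "w \<in> verts H" "\<not> adj H u w"
  shows "nbrs H u = nbrs H w"
proof -
  obtain P where P: "partition_on (verts H) P"
    and adj: "\<And>p q u v. p \<in> P \<Longrightarrow> q \<in> P \<Longrightarrow> u \<in> p \<Longrightarrow> v \<in> q \<Longrightarrow> adj H u v \<longleftrightarrow> p \<noteq> q"
    using assms(1) unfolding complete_multipartite_def by metis
  have part: "\<exists>p\<in>P. y \<in> p" if "y \<in> verts H" for y
    using that P by (auto simp: partition_on_def)
  obtain p where p: "p \<in> P" "u \<in> p" "w \<in> p"
    using part assms(3-5) adj by metis
  have "adj H z u \<longleftrightarrow> adj H z w" if "z \<in> verts H" for z
    using part[OF that] p adj by metis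
  then show ?thesis
    using simple_graph_adjD(1)[OF assms(2)] unfolding nbrs_def by blast
qed

text \<open>Take \<open>v\<close> of minimum degree. If it were adjacent to every other vertex, all
  degrees would be maximal and \<open>H\<close> a clique. Connectivity gives \<open>v\<close> one
  neighbor; if that were the only one, it would be the center of a star.\<close>

lemma multipartite_min_degree_vertex:
  assumes fin: "finite (verts H)" and simple: "simple_graph H" and cm: "complete_multipartite H"
    and conn: "connected_graph H" and card3: "card (verts H) \<ge> 3"
    and not_clique: "\<not> is_clique H" and not_star: "\<not> is_star H"
  obtains v a b c where "v \<in> verts H" "b \<in> verts H" "b \<noteq> v" "\<not> adj H b v"
    "a \<in> nbrs H v" "c \<in> nbrs H v" "a \<noteq> c" "\<And>u. u \<in> verts H \<Longrightarrow> card (nbrs H v) \<le> card (nbrs H u)"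
proof -
  have ne: "verts H \<noteq> {}"
    using card3 by auto
  define v where "v = arg_min_on (\<lambda>u. card (nbrs H u)) (verts H)"
  have v: "v \<in> verts H"
    unfolding v_def by (rule arg_min_if_finite(1)[OF fin ne])
  have min: "card (nbrs H v) \<le> card (nbrs H u)" if "u \<in> verts H" for u
    unfolding v_def by (rule arg_min_least[OF fin ne that])
  have nbrs_sub: "nbrs H u \<subseteq> verts H - {u}" for u
    using simple_graph_adjD[OF simple] unfolding nbrs_def by blast
  have "\<exists>b\<in>verts H. b \<noteq> v \<and> \<not> adj H b v"
  proof (rule ccontr)
    assume "\<not> ?thesis"
    then have "nbrs H v = verts H - {v}"
      using nbrs_sub[of v] by (auto simp: nbrs_def)
    then have "card (verts H) - 1 \<le> card (nbrs H u)" if "u \<in> verts H" for u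
      using min[OF that] v fin by simp
    then have "nbrs H u = verts H - {u}" if "u \<in> verts H" for u
      using that fin nbrs_sub[of u] by (intro card_seteq) auto
    then have "is_clique H"
      unfolding is_clique_def nbrs_def by blast
    then show False
      using not_clique by simp
  qed
  then obtain b where b: "b \<in> verts H" "b \<noteq> v" "\<not> adj H b v"
    by blast
  have "\<exists>a. a \<in> nbrs H v"
  proof -
    have "(adj H)\<^sup>*\<^sup>* v b"
      using conn v b by (auto simp: connected_graph_def)
    then obtain z where "adj H v z"
      using b(2) by (metis converse_rtranclpE)
    then show ?thesis
      using adj_commute[of H v z] by (auto simp: nbrs_def)
  qed
  then obtain a where a: "a \<in> nbrs H v"
    by blast
  have "\<exists>c\<in>nbrs H v. c \<noteq> a"
  proof (rule ccontr)
    assume "\<not> ?thesis"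
    then have va: "nbrs H v = {a}"
      using a by blast
    \<comment> \<open>No vertex other than \<open>a\<close> is adjacent to \<open>v\<close>, so all
      of them are twins of \<open>v\<close>.\<close>
    have nb: "nbrs H w = {a}" if "w \<in> verts H - {a}" for w
    proof -
      have "\<not> adj H w v"
        using that va unfolding nbrs_def by blast
      then show ?thesis
        using complete_multipartite_twins[OF cm simple, of w v] that v va by simp
    qed
    have "edges H = {{a, w} |w. w \<in> verts H - {a}}"
    proof (intro equalityI subsetI)
      fix e assume e: "e \<in> edges H"
      then have "card e = 2"
        using simple by (simp add: simple_graph_def)
      then obtain s t where st: "e = {s, t}" "s \<noteq> t"
        by (auto simp: card_2_iff)
      then have adj: "adj H t s"
        using e by (simp add: adj_def insert_commute)
      then have st_verts: "s \<in> verts H" "t \<in> verts H"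
        using simple_graph_adjD[OF simple] by auto
      have "t = a" if "s \<noteq> a"
      proof -
        have "t \<in> nbrs H s"
          using adj by (simp add: nbrs_def)
        then show ?thesis
          using nb[of s] st_verts that by simp
      qed
      then consider "e = {a, t}" "t \<noteq> a" | "e = {a, s}" "s \<noteq> a"
        using st by (metis insert_commute)
      then show "e \<in> {{a, w} |w. w \<in> verts H - {a}}"
        using st_verts by cases blast+
    next
      fix e assume "e \<in> {{a, w} |w. w \<in> verts H - {a}}"
      then obtain w where w: "w \<in> verts H - {a}" "e = {a, w}"
        by blast
      then have "a \<in> nbrs H w"
        by (simp add: nb)
      then show "e \<in> edges H"
        using w by (simp add: nbrs_def adj_def)
    qed
    moreover have "a \<in> verts H"
      using a nbrs_sub by blast
    ultimately have "is_star H"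
      unfolding is_star_def by blast
    then show False
      using not_star by simp
  qed
  then show ?thesis
    using that v b a min by blast
qed

section \<open>Insertion schedules, indistinguishable histories and the counting argument\<close>

section \<open>Executions\<close>

text \<open>Round \<open>t\<close> inserts the \<open>t\<close>-th entry of the schedule
  \<open>Fs\<close>. The entries are sets so that a round may insert nothing; beyond the end of the
  list the graph stays constant.\<close>

definition grow :: "'a set \<Rightarrow> 'a set set \<Rightarrow> 'a set set list \<Rightarrow> nat \<Rightarrow> 'a ugraph" where
  "grow V E Fs t = UGraph V (E \<union> \<Union> (set (take t Fs)))"

lemma grow_0: "grow V E Fs 0 = UGraph V E"
  by (simp add: grow_def)

lemma nbrs_grow: "nbrs (grow V E Fs t) v = {u. {u, v} \<in> E \<union> \<Union> (set (take t Fs))}"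
  by (simp add: nbrs_def adj_def grow_def)

text \<open>An entry whose edge is already present counts as a round without change, so schedules
  may repeat edges.\<close>

lemma insertion_network_grow:
  assumes simple: "simple_graph (UGraph {1..n} E)"
    and Fs: "\<And>F. F \<in> set Fs \<Longrightarrow> F = {} \<or> (\<exists>u\<in>{1..n}. \<exists>v\<in>{1..n}. u \<noteq> v \<and> F = {{u, v}})"
  shows "insertion_network n (grow {1..n} E Fs)"
proof -
  have "insertion_step (grow {1..n} E Fs t) (grow {1..n} E Fs (Suc t))" for t
  proof (cases "t < length Fs")
    case False
    then show ?thesis
      by (simp add: insertion_step_def grow_def)
  next
    case True
    let ?E = "E \<union> \<Union> (set (take t Fs))"
    have Suc: "grow {1..n} E Fs (Suc t) = UGraph {1..n} (Fs ! t \<union> ?E)"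
      using True by (auto simp: grow_def take_Suc_conv_app_nth)
    show ?thesis
    proof (cases "Fs ! t \<subseteq> ?E")
      case True
      then have "grow {1..n} E Fs (Suc t) = grow {1..n} E Fs t"
        unfolding Suc by (simp add: grow_def Un_absorb1)
      then show ?thesis
        by (simp add: insertion_step_def)
    next
      case False
      then obtain u v where uv: "u \<in> {1..n}" "v \<in> {1..n}" "u \<noteq> v" and F: "Fs ! t = {{u, v}}"
        using Fs[OF nth_mem[OF \<open>t < length Fs\<close>]] by blast
      have "\<not> adj (grow {1..n} E Fs t) u v"
        using False unfolding F by (simp add: grow_def adj_def)
      moreover have "grow {1..n} E Fs (Suc t) =
          UGraph (verts (grow {1..n} E Fs t)) (insert {u, v} (edges (grow {1..n} E Fs t)))"
        unfolding Suc F by (simp add: grow_def)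
      moreover have "u \<in> verts (grow {1..n} E Fs t)" "v \<in> verts (grow {1..n} E Fs t)"
        using uv by (simp_all add: grow_def)
      ultimately show ?thesis
        using uv(3) unfolding insertion_step_def by metis
    qed
  qed
  then show ?thesis
    using simple by (auto simp: insertion_network_def grow_def)
qed

lemma one_round_solvesD:
  assumes "one_round_solves n P A" "insertion_network n G" "1 \<le> t" "v \<in> {1..n}"
  shows "outp A v (G 0) (history A G t v) \<longleftrightarrow> P (G t) v"
  using assms unfolding one_round_solves_def by blast

lemma history_cong:
  "(\<And>s. s \<le> t \<Longrightarrow> G s = G' s) \<Longrightarrow> history A G t = history A G' t"
proof (induction t)
  case (Suc t)
  then have "history A G t = history A G' t" "G 0 = G' 0" "G (Suc t) = G' (Suc t)"
    by auto
  then show ?case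
    by (simp only: history.simps)
qed simp

text \<open>Messages between members of \<open>W\<close> agree by induction, because their senders
  have equal histories and neighbor lists. Only messages that enter \<open>W\<close> from outside
  have to be compared by hypothesis.\<close>

lemma history_cong_cut:
  assumes "G 0 = G' 0"
    and nb: "\<And>s v. s < t \<Longrightarrow> v \<in> W \<Longrightarrow> nbrs (G (Suc s)) v = nbrs (G' (Suc s)) v"
    and msg: "\<And>s u v. s < t \<Longrightarrow> v \<in> W \<Longrightarrow> u \<in> nbrs (G (Suc s)) v - W \<Longrightarrow>
      send A u (G 0) (history A G s u) (nbrs (G (Suc s)) u) v =
      send A u (G 0) (history A G' s u) (nbrs (G' (Suc s)) u) v"
    and "v \<in> W"
  shows "history A G t v = history A G' t v"
  using nb msg \<open>v \<in> W\<close>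
proof (induction t arbitrary: v)
  case (Suc t)
  have IH: "history A G t u = history A G' t u" if "u \<in> W" for u
    using Suc.IH[OF _ _ that] Suc.prems(1,2) by (simp add: less_Suc_eq)
  have "send A u (G 0) (history A G t u) (nbrs (G (Suc t)) u) v =
      send A u (G 0) (history A G' t u) (nbrs (G' (Suc t)) u) v"
    if "u \<in> nbrs (G (Suc t)) v" for u
  proof (cases "u \<in> W")
    case True
    then show ?thesis
      by (simp add: IH Suc.prems(1))
  next
    case False
    then show ?thesis
      using Suc.prems(2)[of t v u] Suc.prems(3) that by simp
  qed
  moreover have "nbrs (G (Suc t)) v = nbrs (G' (Suc t)) v"
    using Suc.prems(1,3) by simp
  ultimately show ?case
    using IH[OF Suc.prems(3)] \<open>G 0 = G' 0\<close>[symmetric]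
    by (simp add: fun_eq_iff)
qed simp

text \<open>While \<open>S\<close> is encoded by the edges at \<open>c\<close>, \<open>a\<close> and \<open>v\<close> are isolated. From then on all
  information about \<open>S\<close> that reaches \<open>a\<close> and \<open>v\<close> in time comes in messages from \<open>Q\<close>. These messages
  do not depend on \<open>x\<close>, whose edge to \<open>a\<close> is inserted last, and so they determine \<open>S\<close>.\<close>

lemma one_round_cut_bound:
  fixes a c v :: nat and Q X :: "nat set" and es :: "nat set list"
  assumes bw: "has_bandwidth B A" and solves: "one_round_solves n P A"
    and simple: "simple_graph (UGraph {1..n} E)"
    and isolated: "\<And>e. e \<in> E \<Longrightarrow> a \<notin> e \<and> v \<notin> e"
    and XV: "X \<subseteq> {1..n}" and QV: "Q \<subseteq> {1..n}" and QX: "Q \<inter> X = {}"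
    and avc: "a \<in> Q" "v \<in> Q" "c \<in> Q" "a \<noteq> v" "a \<noteq> c" "v \<noteq> c"
    and es: "\<And>e. e \<in> set es \<Longrightarrow> e \<subseteq> Q \<and> card e = 2"
    and P: "\<And>S x. S \<subseteq> X \<Longrightarrow> x \<in> X \<Longrightarrow>
      P (UGraph {1..n} (E \<union> (\<lambda>y. {c, y}) ` S \<union> set es \<union> {{a, x}})) v \<longleftrightarrow> x \<in> S"
  shows "card X \<le> Suc (length es) * 2 * card Q * B"
proof -
  have finX: "finite X" and finQ: "finite Q"
    using XV QV by (auto intro: finite_subset)
  obtain xs where xs: "set xs = X"
    using finite_list[OF finX] by blast
  \<comment> \<open>The empty entries keep the time at which the encoding ends independent of \<open>S\<close>.\<close>
  define code where "code S = map (\<lambda>y. if y \<in> S then {{c, y}} else {}) xs" for S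
  define T where "T = length xs"
  define K where "K = length es"
  define Fs where "Fs S = code S @ map (\<lambda>e. {e}) es" for S
  \<comment> \<open>\<open>G S\<close> lacks the final edge \<open>{a, x}\<close>, which
    \<open>N S x\<close> inserts in round \<open>T + K + 1\<close>. Everything up to round
    \<open>T + K\<close> is therefore independent of \<open>x\<close>.\<close>
  define G where "G S = grow {1..n} E (Fs S)" for S
  define N where "N S x = grow {1..n} E (Fs S @ [{{a, x}}])" for S x
  have len: "length (code S) = T" "length (Fs S) = T + K" for S
    by (simp_all add: code_def T_def K_def Fs_def)
  have code_sub: "\<Union> (set (take t (code S))) \<subseteq> (\<lambda>y. {c, y}) ` X" for t S
    using xs by (auto simp: code_def dest!: in_set_takeD split: if_splits)
  have code_all: "\<Union> (set (code S)) = (\<lambda>y. {c, y}) ` S" if "S \<subseteq> X" for S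
    using xs that by (auto simp: code_def split: if_splits)
  have UN_single: "\<Union> (set (map (\<lambda>e. {e}) ys)) = set ys" for ys :: "nat set list"
    by auto
  have take_Fs: "\<Union> (set (take t (Fs S))) = \<Union> (set (take t (code S))) \<union> set (take (t - T) es)" for t S
    unfolding Fs_def take_append len set_append Union_Un_distrib take_map UN_single ..
  have code_av: "w \<notin> e" if e: "e \<in> \<Union> (set (take t (code S)))" and w: "w \<in> {a, v}" for e w t S
  proof -
    obtain y where "y \<in> X" "e = {c, y}"
      using subsetD[OF code_sub e] by blast
    moreover have "w \<noteq> c" "w \<notin> X"
      using w avc QX by auto
    ultimately show ?thesis
      by auto
  qed
  have nbrs_av: "nbrs (G S t) w = {u. {u, w} \<in> set (take (t - T) es)}" if "w \<in> {a, v}" for S t w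
  proof -
    have "{u, w} \<notin> E" "{u, w} \<notin> \<Union> (set (take t (code S)))" for u
      using that isolated[of "{u, w}"] code_av[of "{u, w}" t S w] by blast+
    then show ?thesis
      unfolding G_def nbrs_grow take_Fs by simp
  qed
  have nbrs_av_Q: "nbrs (G S t) w \<subseteq> Q - {w}" if "w \<in> {a, v}" for S t w
  proof
    fix u assume "u \<in> nbrs (G S t) w"
    then have "{u, w} \<in> set es"
      unfolding nbrs_av[OF that] by (blast dest: in_set_takeD)
    from es[OF this] show "u \<in> Q - {w}"
      by (cases "u = w") simp_all
  qed
  have G_N: "N S x t = G S t" if "t \<le> T + K" for S x t
    using that len by (simp add: G_def N_def grow_def)
  have G_0: "G S 0 = UGraph {1..n} E" "N S x 0 = UGraph {1..n} E" for S x
    by (simp_all add: G_def N_def grow_0)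
  have nbrs_N: "nbrs (N S x (Suc (T + K))) u =
      nbrs (G S (Suc (T + K))) u \<union> {y. {y, u} = {a, x}}" for S x u
    using len by (auto simp: G_def N_def nbrs_grow)

  \<comment> \<open>A triple stands for round \<open>t + 1\<close>, receiver \<open>w\<close> and
    sender \<open>u\<close>. The range has \<open>K + 1\<close> values: the \<open>K\<close> rounds
    that insert \<open>es\<close> and the round of the final edge.\<close>
  define I where "I = {T..T + K} \<times> {a, v} \<times> Q"
  \<comment> \<open>As \<open>send\<close> is total, a message is recorded even if \<open>u\<close>
    and \<open>w\<close> are not adjacent. The restriction to \<open>I\<close> places
    \<open>M S\<close> in a finite extensional function space.\<close>
  define M where "M S = (\<lambda>(t, w, u)\<in>I.
    send A u (UGraph {1..n} E) (history A (G S) t u) (nbrs (G S (Suc t)) u) w)" for S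
  have M_eq: "send A u (UGraph {1..n} E) (history A (G S) t u) (nbrs (G S (Suc t)) u) w =
      send A u (UGraph {1..n} E) (history A (G S') t u) (nbrs (G S' (Suc t)) u) w"
    if "M S = M S'" "T \<le> t" "t \<le> T + K" "w \<in> {a, v}" "u \<in> Q" for S S' t w u
  proof -
    have "(t, w, u) \<in> I"
      using that by (simp add: I_def)
    then show ?thesis
      using fun_cong[OF that(1), of "(t, w, u)"] by (simp add: M_def)
  qed

  have "x \<in> S \<longleftrightarrow> x \<in> S'" if S: "S \<subseteq> X" "S' \<subseteq> X" and M: "M S = M S'" and x: "x \<in> X" for S S' x
  proof -
    have xQ: "x \<notin> Q"
      using x QX by auto
    have hist: "history A (G S) (T + K) w = history A (G S') (T + K) w" if w: "w \<in> {a, v}" for w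
    proof (rule history_cong_cut[OF _ _ _ w])
      show "G S 0 = G S' 0"
        by (simp add: G_0)
      show "nbrs (G S (Suc s)) y = nbrs (G S' (Suc s)) y" if "y \<in> {a, v}" for s y
        by (simp only: nbrs_av[OF that])
      fix s u y
      assume sy: "s < T + K" "y \<in> {a, v}" and u: "u \<in> nbrs (G S (Suc s)) y - {a, v}"
      \<comment> \<open>Up to round \<open>T\<close> the vertices \<open>a\<close> and
        \<open>v\<close> have no neighbors, hence receive nothing.\<close>
      have "T \<le> s"
      proof (rule ccontr)
        assume "\<not> T \<le> s"
        then show False
          using u unfolding nbrs_av[OF sy(2)] by simp
      qed
      then show "send A u (G S 0) (history A (G S) s u) (nbrs (G S (Suc s)) u) y =
          send A u (G S 0) (history A (G S') s u) (nbrs (G S' (Suc s)) u) y"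
        unfolding G_0 using M_eq[OF M, of s y u] sy u nbrs_av_Q[OF sy(2)] by auto
    qed
    have hist_N: "history A (N R x) (T + K) = history A (G R) (T + K)" for R
      by (rule history_cong) (rule G_N)
    have nbrs_v: "nbrs (N R x (Suc (T + K))) v = nbrs (G S (Suc (T + K))) v" for R
      using avc xQ by (auto simp: nbrs_N doubleton_eq_iff nbrs_av)
    have nbrs_a: "nbrs (N R x (Suc (T + K))) a = nbrs (N S x (Suc (T + K))) a" for R
      unfolding nbrs_N nbrs_av[of a, simplified] ..
    have nbrs_u: "nbrs (N R x (Suc (T + K))) u = nbrs (G R (Suc (T + K))) u" if "u \<in> Q - {a}" for R u
      unfolding nbrs_N using that xQ by (auto simp: doubleton_eq_iff)
    have msg: "send A u (UGraph {1..n} E) (history A (G S) (T + K) u) (nbrs (N S x (Suc (T + K))) u) v =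
        send A u (UGraph {1..n} E) (history A (G S') (T + K) u) (nbrs (N S' x (Suc (T + K))) u) v"
      if "u \<in> nbrs (G S (Suc (T + K))) v" for u
    \<comment> \<open>Within \<open>Q\<close>, only \<open>a\<close> notices the final edge. Its
      neighbor list depends on \<open>x\<close> but not on \<open>S\<close>, and its history is the
      same for \<open>S\<close> and \<open>S'\<close>. Any other sender acts as in \<open>G\<close>,
      so its message is recorded in \<open>M\<close>.\<close>
    proof (cases "u = a")
      case True
      then show ?thesis
        using hist[of a] nbrs_a[of S'] by simp
    next
      case False
      then have "u \<in> Q - {a}"
        using that nbrs_av_Q[of v S "Suc (T + K)"] by auto
      then show ?thesis
        using M_eq[OF M, of "T + K" v u] by (simp add: nbrs_u)
    qed
    have same: "history A (N S x) (Suc (T + K)) v = history A (N S' x) (Suc (T + K)) v"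
      using msg hist[of v] by (simp add: hist_N nbrs_v G_0 fun_eq_iff)
    have out: "outp A v (UGraph {1..n} E) (history A (N R x) (Suc (T + K)) v) \<longleftrightarrow> x \<in> R"
      if R: "R \<subseteq> X" for R
    proof -
      have "insertion_network n (N R x)"
        unfolding N_def
      proof (rule insertion_network_grow[OF simple])
        fix F assume "F \<in> set (Fs R @ [{{a, x}}])"
        then consider "F \<in> set (code R)" | e where "e \<in> set es" "F = {e}" | "F = {{a, x}}"
          by (auto simp: Fs_def)
        then show "F = {} \<or> (\<exists>u\<in>{1..n}. \<exists>v\<in>{1..n}. u \<noteq> v \<and> F = {{u, v}})"
        proof cases
          case 1
          then obtain y where y: "y \<in> X" "F = {} \<or> F = {{c, y}}"
            using xs by (auto simp: code_def split: if_splits)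
          then have "c \<in> {1..n}" "y \<in> {1..n}" "c \<noteq> y"
            using avc QV XV QX by auto
          then show ?thesis
            using y(2) by blast
        next
          case 2
          then obtain u w where "e = {u, w}" "u \<noteq> w"
            using es by (meson card_2_iff)
          moreover have "u \<in> {1..n}" "w \<in> {1..n}"
            using es[OF 2(1)] calculation QV by auto
          ultimately show ?thesis
            using 2 by blast
        next
          case 3
          have "a \<in> {1..n}" "x \<in> {1..n}" "a \<noteq> x"
            using avc QV XV x xQ by auto
          then show ?thesis
            using 3 by blast
        qed
      qed
      moreover have "v \<in> {1..n}"
        using avc QV by auto
      ultimately have "outp A v (UGraph {1..n} E) (history A (N R x) (Suc (T + K)) v) \<longleftrightarrow>
          P (N R x (Suc (T + K))) v"
        unfolding G_0(2)[of R x, symmetric] by (intro one_round_solvesD[OF solves]) simp_all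
      moreover have "N R x (Suc (T + K)) =
          UGraph {1..n} (E \<union> (\<lambda>y. {c, y}) ` R \<union> set es \<union> {{a, x}})"
        using len take_Fs[of "T + K" R] code_all[OF R]
        by (simp add: N_def grow_def K_def Un_ac)
      ultimately show ?thesis
        using P[OF R x] by simp
    qed
    show ?thesis
      using out[OF S(1)] out[OF S(2)] same by simp
  qed
  then have "inj_on M (Pow X)"
    by (intro inj_onI) blast
  moreover have "M ` Pow X \<subseteq> I \<rightarrow>\<^sub>E {m. length m = B}"
    using bw by (auto simp: M_def has_bandwidth_def)
  moreover have bits: "card {m :: message. length m = B} = 2 ^ B" "finite {m :: message. length m = B}"
    using card_lists_length_eq[of "UNIV :: bool set" B] finite_lists_length_eq[of "UNIV :: bool set" B]
    by simp_all
  moreover have finI: "finite I"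
    using finQ by (simp add: I_def)
  ultimately have "card (Pow X) \<le> card (I \<rightarrow>\<^sub>E {m :: message. length m = B})"
    by (meson card_inj_on_le finite_PiE)
  then have "(2::nat) ^ card X \<le> 2 ^ (card I * B)"
    using finX finI bits by (simp add: card_Pow card_funcsetE power_mult mult.commute)
  then have "card X \<le> card I * B"
    by simp
  also have "card I = Suc (length es) * 2 * card Q"
    using avc(4) by (simp add: I_def K_def card_cartesian_product)
  finally show ?thesis .
qed

section \<open>The blow-up of \<open>H\<close>, correctness of the reduction and the asymptotic
  bound\<close>

section \<open>The lower bound\<close>

text \<open>The cut bound is applied to the blow-up of \<open>H\<close> at \<open>b0\<close>. The
  factor arises from at most \<open>2 * (h - 1)\<close> edges in \<open>es\<close>, two receivers
  and \<open>h - 1\<close> senders.\<close>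

lemma MemDetect_multipartite_bandwidth:
  fixes H :: "'a ugraph"
  assumes fin: "finite (verts H)" and simple: "simple_graph H"
    and cm: "complete_multipartite H" and conn: "connected_graph H" and card3: "card (verts H) \<ge> 3"
    and not_clique: "\<not> is_clique H" and not_star: "\<not> is_star H"
    and bw: "has_bandwidth B A" and solves: "one_round_solves n (MemDetect H) A"
    and n: "card (verts H) \<le> n"
  shows "Suc n - card (verts H) \<le> 4 * (card (verts H))\<^sup>2 * B"
proof -
  define h where "h = card (verts H)"
  obtain v0 a0 b0 c0 where v0: "v0 \<in> verts H" and b0: "b0 \<in> verts H" "b0 \<noteq> v0" "\<not> adj H b0 v0"
    and a0c0: "a0 \<in> nbrs H v0" "c0 \<in> nbrs H v0" "a0 \<noteq> c0"
    and min: "\<And>u. u \<in> verts H \<Longrightarrow> card (nbrs H v0) \<le> card (nbrs H u)"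
    using multipartite_min_degree_vertex[OF assms(1-7)] by metis
  have adjD: "u \<in> verts H" "w \<in> verts H" "u \<noteq> w" if "adj H u w" for u w
    using simple_graph_adjD[OF simple that] by auto
  have nb: "nbrs H u \<subseteq> verts H" "finite (nbrs H u)" for u
  proof -
    show "nbrs H u \<subseteq> verts H"
      using adjD by (auto simp: nbrs_def)
    then show "finite (nbrs H u)"
      using fin by (rule finite_subset)
  qed
  have irr: "\<not> adj H u u" for u
    using adjD(3) by blast
  \<comment> \<open>\<open>Q\<close> represents the \<open>h - 1\<close> vertices of
    \<open>H\<close> other than \<open>b0\<close>; the remaining \<open>n - h + 1\<close> nodes in
    \<open>X\<close> are the copies of \<open>b0\<close>.\<close>
  define Q where "Q = {1..<h}"
  define X where "X = {h..n}"
  define V where "V = {1..n}"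
  have h3: "h \<ge> 3" "h \<le> n"
    using card3 n by (auto simp: h_def)
  have QXV: "Q \<union> X = V" "Q \<inter> X = {}"
    using h3 by (auto simp: Q_def X_def V_def)
  have "card Q = card (verts H - {b0})"
    using b0 fin by (simp add: Q_def h_def)
  then obtain q where q: "bij_betw q Q (verts H - {b0})"
    using finite_same_card_bij[of Q "verts H - {b0}"] fin by (auto simp: Q_def)
  \<comment> \<open>\<open>\<psi>\<close> projects the blow-up onto \<open>H\<close>; all of \<open>X\<close> goes to \<open>b0\<close>.\<close>
  define \<psi> where "\<psi> y = (if y \<in> Q then q y else b0)" for y
  have \<psi>Q: "\<psi> y \<in> verts H - {b0}" if "y \<in> Q" for y
    using that bij_betwE[OF q] by (auto simp: \<psi>_def)
  have \<psi>X: "\<psi> y = b0" if "y \<in> X" for y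
    using that QXV by (auto simp: \<psi>_def)
  have bij: "bij_betw \<psi> Q (verts H - {b0})"
    using q by (subst bij_betw_cong[of _ _ q]) (auto simp: \<psi>_def)
  have lift: "\<exists>y\<in>Q. \<psi> y = u" if "u \<in> verts H" "u \<noteq> b0" for u
  proof -
    have "u \<in> \<psi> ` Q"
      using that bij by (simp add: bij_betw_def)
    then show ?thesis
      by blast
  qed
  have \<psi>_inj: "y = z" if "\<psi> y = \<psi> z" "y \<in> Q" "z \<in> Q" for y z
    using that bij by (auto simp: bij_betw_def inj_on_def)
  have "a0 \<in> verts H" "c0 \<in> verts H" "a0 \<noteq> b0" "c0 \<noteq> b0"
    using a0c0 nb b0 by (auto simp: nbrs_def)
  then obtain a c v where lifts: "a \<in> Q" "c \<in> Q" "v \<in> Q" "\<psi> a = a0" "\<psi> c = c0" "\<psi> v = v0"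
    using lift v0 b0 by metis
  have distinct: "a \<noteq> v" "a \<noteq> c" "v \<noteq> c"
    using lifts a0c0 irr by (auto simp: nbrs_def)

  \<comment> \<open>The initial graph has all blow-up edges that avoid \<open>a\<close> and
    \<open>v\<close>, except those between \<open>c\<close> and \<open>X\<close>, which are left
    free to encode \<open>S\<close>.\<close>
  define E where "E = {{y, z} |y z. y \<in> V - {a, v} \<and> z \<in> V - {a, v} \<and> adj H (\<psi> y) (\<psi> z) \<and>
    \<not> (y = c \<and> z \<in> X) \<and> \<not> (z = c \<and> y \<in> X)}"
  \<comment> \<open>Edges from \<open>a\<close> and \<open>v\<close> into \<open>Q\<close>. The edge
    \<open>{a, v}\<close> is listed twice, which is harmless.\<close>
  define es where "es = map (\<lambda>(y, z). {y, z})
    (filter (\<lambda>(y, z). adj H (\<psi> y) (\<psi> z)) (List.product [a, v] [1..<h]))"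
  have set_es: "set es = {{y, z} |y z. y \<in> {a, v} \<and> z \<in> Q \<and> adj H (\<psi> y) (\<psi> z)}"
  proof -
    have "set es = (\<lambda>(y, z). {y, z}) ` {(y, z). y \<in> {a, v} \<and> z \<in> Q \<and> adj H (\<psi> y) (\<psi> z)}"
      unfolding es_def set_map by (rule arg_cong[where f = "image _"]) (auto simp: Q_def)
    also have "\<dots> = {{y, z} |y z. y \<in> {a, v} \<and> z \<in> Q \<and> adj H (\<psi> y) (\<psi> z)}"
      by fast
    finally show ?thesis .
  qed
  have "length es \<le> length (List.product [a, v] [1..<h])"
    unfolding es_def length_map by (rule length_filter_le)
  then have len_es: "length es \<le> 2 * (h - 1)"
    by (simp add: length_product)

  have "nbrs H b0 = nbrs H v0"
    using complete_multipartite_twins[OF cm simple b0(1) v0 b0(3)] .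
  then have ab0: "adj H a0 b0" and cb0: "adj H c0 b0"
    using a0c0 by (auto simp: nbrs_def)
  have notX: "a \<notin> X" "c \<notin> X" "v \<notin> X"
    using lifts QXV by auto
  \<comment> \<open>Adjacency in the final graph is pulled back from \<open>H\<close> along
    \<open>\<psi>\<close>, subject to this restriction on edges into \<open>X\<close>. It is
    one-sided and hence imposed in both directions.\<close>
  define allowed where "allowed S x y z \<longleftrightarrow>
    (z \<in> X \<longrightarrow> (y = c \<longrightarrow> z \<in> S) \<and> (y = a \<longrightarrow> z = x))" for S :: "nat set" and x y z :: nat
  define \<Gamma> where "\<Gamma> S x = UGraph V (E \<union> (\<lambda>y. {c, y}) ` S \<union> set es \<union> {{a, x}})" for S x
  have adj_\<Gamma>: "adj (\<Gamma> S x) y z \<longleftrightarrow>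
      y \<in> V \<and> z \<in> V \<and> adj H (\<psi> y) (\<psi> z) \<and> allowed S x y z \<and> allowed S x z y"
    (is "_ \<longleftrightarrow> ?rel y z") if S: "S \<subseteq> X" "x \<in> X" for S x y z
  proof
    have sym: "?rel p r \<Longrightarrow> ?rel r p" for p r
      using adj_commute[of H] by blast
    assume "adj (\<Gamma> S x) y z"
    then consider "{y, z} \<in> E" | s where "s \<in> S" "{y, z} = {c, s}" | "{y, z} \<in> set es" | "{y, z} = {a, x}"
      by (auto simp: \<Gamma>_def adj_UGraph)
    \<comment> \<open>An edge fixes its endpoints only up to order, so the symmetric relation is
      verified for one orientation.\<close>
    then have "\<exists>p r. {y, z} = {p, r} \<and> ?rel p r"
    proof cases
      case 1
      then obtain p r where pr: "{y, z} = {p, r}" "p \<in> V - {a, v}" "r \<in> V - {a, v}"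
        "adj H (\<psi> p) (\<psi> r)" "\<not> (p = c \<and> r \<in> X)" "\<not> (r = c \<and> p \<in> X)"
        unfolding E_def mem_Collect_eq by metis
      then have "?rel p r"
        unfolding allowed_def by blast
      with pr(1) show ?thesis
        by metis
    next
      case 2
      then have s: "s \<in> X"
        using S by blast
      then have "c \<in> V" "s \<in> V"
        using lifts QXV by blast+
      then have "?rel c s"
        using 2 s cb0 lifts(5) distinct notX \<psi>X[OF s] by (simp add: allowed_def)
      with 2(2) show ?thesis
        by metis
    next
      case 3
      then obtain p r where pr: "{y, z} = {p, r}" "p \<in> Q" "r \<in> Q" "adj H (\<psi> p) (\<psi> r)"
        using lifts(1,3) unfolding set_es mem_Collect_eq by (metis insertE singletonD)
      then have "p \<in> V - X" "r \<in> V - X"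
        using QXV by blast+
      then have "?rel p r"
        using pr(4) by (simp add: allowed_def)
      with pr(1) show ?thesis
        by metis
    next
      case 4
      have "a \<in> V" "x \<in> V"
        using S lifts QXV by blast+
      then have "?rel a x"
        using ab0 lifts(4) distinct notX \<psi>X[OF S(2)] by (simp add: allowed_def)
      with 4 show ?thesis
        by metis
    qed
    then show "?rel y z"
      using sym by (metis doubleton_eq_iff)
  next
    have edge: "adj (\<Gamma> S x) y z" if "y \<in> {a, v}" "z \<in> V" "adj H (\<psi> y) (\<psi> z)" "allowed S x y z" for y z
    proof (cases "z \<in> X")
      case True
      \<comment> \<open>\<open>v\<close> has no neighbor in \<open>X\<close> because
        \<open>v0\<close> and \<open>b0\<close> are not adjacent.\<close>
      have "y \<noteq> v"
        using that(3) b0(3) lifts(6) \<psi>X[OF True] adj_commute[of H b0 v0] by auto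
      then have "y = a" "z = x"
        using that(1,4) True by (simp_all add: allowed_def)
      then show ?thesis
        by (simp add: \<Gamma>_def adj_UGraph)
    next
      case False
      then have "z \<in> Q"
        using that(2) QXV by blast
      then have "{y, z} \<in> set es"
        using that(1,3) unfolding set_es mem_Collect_eq by metis
      then show ?thesis
        by (simp add: \<Gamma>_def adj_UGraph)
    qed
    have edge_c: "adj (\<Gamma> S x) y z" if "y = c" "z \<in> X" "allowed S x y z" for y z
      using that by (simp add: \<Gamma>_def adj_UGraph allowed_def)
    assume R: "?rel y z"
    then have R': "adj H (\<psi> z) (\<psi> y)"
      using adj_commute[of H] by blast
    consider "y \<in> {a, v}" | "z \<in> {a, v}" | "y = c" "z \<in> X" | "z = c" "y \<in> X"
      | "y \<in> V - {a, v}" "z \<in> V - {a, v}" "\<not> (y = c \<and> z \<in> X)" "\<not> (z = c \<and> y \<in> X)"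
      using R by blast
    then show "adj (\<Gamma> S x) y z"
    proof cases
      case 1
      then show ?thesis
        using R by (intro edge) simp_all
    next
      case 2
      then have "adj (\<Gamma> S x) z y"
        using R R' by (intro edge) simp_all
      then show ?thesis
        by (simp only: adj_commute)
    next
      case 3
      then show ?thesis
        using R by (intro edge_c) simp_all
    next
      case 4
      then have "adj (\<Gamma> S x) z y"
        using R by (intro edge_c) simp_all
      then show ?thesis
        by (simp only: adj_commute)
    next
      case 5
      then have "{y, z} \<in> E"
        using R unfolding E_def mem_Collect_eq by metis
      then show ?thesis
        by (simp add: \<Gamma>_def adj_UGraph)
    qed
  qed

  have "MemDetect H (\<Gamma> S x) v \<longleftrightarrow> x \<in> S" if S: "S \<subseteq> X" "x \<in> X" for S x
  proof
    assume xS: "x \<in> S"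
    \<comment> \<open>The copy uses \<open>x\<close> for \<open>b0\<close> and the representative in
      \<open>Q\<close> for every other vertex. For \<open>x\<close> in \<open>S\<close> no edge at
      \<open>x\<close> is suppressed.\<close>
    define g where "g u = (if u = b0 then x else inv_into Q \<psi> u)" for u
    have gQ: "g u \<in> Q" "\<psi> (g u) = u" if "u \<in> verts H" "u \<noteq> b0" for u
      using that bij by (auto simp: g_def bij_betw_def inv_into_into f_inv_into_f)
    have gb: "g b0 = x"
      by (simp add: g_def)
    have \<psi>g: "\<psi> (g u) = u" if "u \<in> verts H" for u
      using that gQ gb \<psi>X[OF S(2)] by (cases "u = b0") auto
    have gV: "g u \<in> V" if "u \<in> verts H" for u
      using that gQ gb S QXV by (cases "u = b0") auto
    have al: "allowed S x y (g u)" if "u \<in> verts H" for u y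
      using that gQ(1)[of u] gb xS QXV by (cases "u = b0") (auto simp: allowed_def)
    have "inj_on g (verts H)"
      by (rule inj_on_inverseI) (rule \<psi>g)
    moreover have "adj (\<Gamma> S x) (g u) (g w)" if "adj H u w" for u w
      using adjD[OF that] that by (simp add: adj_\<Gamma>[OF S] gV \<psi>g al)
    moreover have "g v0 = v"
      using gQ[OF v0] b0 lifts \<psi>_inj by auto
    ultimately show "MemDetect H (\<Gamma> S x) v"
      unfolding MemDetect_iff[OF simple] using v0 gV
      by (intro exI[of _ g]) (auto simp: \<Gamma>_def)
  next
    assume "MemDetect H (\<Gamma> S x) v"
    then obtain g u0 where g: "inj_on g (verts H)" "g ` verts H \<subseteq> V"
      and hom: "\<And>u w. adj H u w \<Longrightarrow> adj (\<Gamma> S x) (g u) (g w)"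
      and u0: "u0 \<in> verts H" "g u0 = v"
      unfolding MemDetect_iff[OF simple] by (auto simp: \<Gamma>_def)
    \<comment> \<open>The neighborhood of \<open>v\<close> in every \<open>\<Gamma> S x\<close>; its
      size is the minimum degree of \<open>H\<close>.\<close>
    define D where "D = {y \<in> Q. adj H (\<psi> y) v0}"
    have \<psi>D: "\<psi> ` D = nbrs H v0"
    proof
      show "nbrs H v0 \<subseteq> \<psi> ` D"
      proof
        fix u assume u: "u \<in> nbrs H v0"
        then have "u \<in> verts H" "u \<noteq> b0"
          using nb b0 by (auto simp: nbrs_def)
        then show "u \<in> \<psi> ` D"
          using lift u by (force simp: D_def nbrs_def)
      qed
    qed (auto simp: D_def nbrs_def)
    have finD: "finite D"
      by (simp add: D_def Q_def)
    have cardD: "card D = card (nbrs H v0)"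
      using \<psi>D \<psi>_inj by (metis (no_types, lifting) D_def card_image inj_onI mem_Collect_eq)
    \<comment> \<open>The neighbors of \<open>u0\<close> are mapped injectively into
      \<open>D\<close>, and minimality of the degree of \<open>v0\<close> leaves no element of
      \<open>D\<close> uncovered.\<close>
    have gN: "g ` nbrs H u0 = D"
    proof (rule card_seteq[OF finD])
      show "g ` nbrs H u0 \<subseteq> D"
      proof
        fix y assume "y \<in> g ` nbrs H u0"
        then have "adj (\<Gamma> S x) y v"
          using hom u0 by (force simp: nbrs_def)
        then have y: "y \<in> V" "adj H (\<psi> y) v0"
          using adj_\<Gamma>[OF S] lifts by auto
        then have "y \<notin> X"
          using \<psi>X b0 by auto
        then show "y \<in> D"
          using y QXV by (auto simp: D_def)
      qed
      have "card (g ` nbrs H u0) = card (nbrs H u0)"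
        using g(1) nb by (meson card_image inj_on_subset)
      then show "card D \<le> card (g ` nbrs H u0)"
        using min[OF u0(1)] cardD by simp
    qed
    have ac: "a \<in> D" "c \<in> D"
      using lifts a0c0 by (auto simp: D_def nbrs_def)
    show "x \<in> S"
    proof (rule ccontr)
      assume xS: "x \<notin> S"
      \<comment> \<open>The part of \<open>u0\<close>. Its image will be squeezed into the part of
        \<open>v0\<close> without \<open>b0\<close>, which has one vertex too few.\<close>
      let ?P = "verts H - nbrs H u0"
      have gP: "g w \<in> Q \<and> \<psi> (g w) \<in> verts H - nbrs H v0 - {b0}" if w: "w \<in> ?P" for w
      proof -
        have "nbrs H w = nbrs H u0"
          using complete_multipartite_twins[OF cm simple, of w u0] w u0 by (auto simp: nbrs_def)
        then have adjD': "adj (\<Gamma> S x) y (g w)" if "y \<in> D" for y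
          using that gN hom by (auto simp: nbrs_def)
        \<comment> \<open>A copy in \<open>X\<close> adjacent to both \<open>a\<close> and
          \<open>c\<close> must equal \<open>x\<close> and belong to \<open>S\<close>.\<close>
        have "g w \<notin> X"
          using adjD'[OF ac(1)] adjD'[OF ac(2)] xS unfolding adj_\<Gamma>[OF S] allowed_def by auto
        moreover have "g w \<in> V"
          using g(2) w by auto
        ultimately have gQ: "g w \<in> Q"
          using QXV by auto
        moreover have "\<psi> (g w) \<notin> nbrs H v0"
        \<comment> \<open>Otherwise \<open>g w\<close> would lie in \<open>D\<close> and be adjacent
          to itself.\<close>
        proof
          assume "\<psi> (g w) \<in> nbrs H v0"
          then have "g w \<in> D"
            using gQ by (simp add: D_def nbrs_def)
          then show False
            using adjD' irr adj_\<Gamma>[OF S] by blast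
        qed
        ultimately show ?thesis
          using \<psi>Q by auto
      qed
      have "inj_on (\<lambda>w. \<psi> (g w)) ?P"
        using gP g(1) \<psi>_inj by (intro inj_onI) (meson DiffD1 inj_onD)
      then have "card ?P \<le> card (verts H - nbrs H v0 - {b0})"
        using gP fin by (intro card_inj_on_le[of "\<lambda>w. \<psi> (g w)"]) auto
      also have "\<dots> < card (verts H - nbrs H v0)"
        using b0 fin by (intro psubset_card_mono) (auto simp: nbrs_def)
      also have "\<dots> = card (verts H) - card (nbrs H v0)"
        using nb by (intro card_Diff_subset) auto
      also have "card (nbrs H v0) = card (nbrs H u0)"
        using gN cardD g(1) nb by (metis card_image inj_on_subset)
      also have "card (verts H) - card (nbrs H u0) = card ?P"
        using nb by (intro card_Diff_subset[symmetric]) auto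
      finally show False
        by simp
    qed
  qed
  then have P: "MemDetect H (UGraph {1..n} (E \<union> (\<lambda>y. {c, y}) ` S \<union> set es \<union> {{a, x}})) v \<longleftrightarrow> x \<in> S"
    if "S \<subseteq> X" "x \<in> X" for S x
    using that by (simp only: \<Gamma>_def V_def)
  have card_edge: "card {y, z} = 2" if "adj H (\<psi> y) (\<psi> z)" for y z
    using that irr by (metis card_2_iff)
  have "card X \<le> Suc (length es) * 2 * card Q * B"
  proof (rule one_round_cut_bound[OF bw solves _ _ _ _ QXV(2) lifts(1,3,2) distinct _ P])
    show "simple_graph (UGraph {1..n} E)"
      using card_edge by (auto simp: simple_graph_def E_def V_def)
    show "a \<notin> e \<and> v \<notin> e" if "e \<in> E" for e
      using that by (auto simp: E_def)
    show "X \<subseteq> {1..n}" "Q \<subseteq> {1..n}"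
      using QXV by (auto simp: V_def)
    show "e \<subseteq> Q \<and> card e = 2" if "e \<in> set es" for e
      using that card_edge lifts unfolding set_es by auto
  qed
  also have "\<dots> \<le> (2 * h) * 2 * h * B"
    using len_es h3 by (intro mult_mono) (auto simp: Q_def)
  finally show ?thesis
    by (simp add: X_def h_def power2_eq_square mult_ac)
qed

theorem theorem6p5:
  fixes H :: "'a ugraph"
  assumes "finite (verts H)" and "simple_graph H"
    and "complete_multipartite H" and "connected_graph H" and "card (verts H) \<ge> 3"
    and "\<not> is_clique H" and "\<not> is_star H"
  shows "enat_bigomega (one_round_bandwidth (MemDetect H)) (\<lambda>n. real n)"
proof -
  define h where "h = card (verts H)"
  have h: "h \<ge> 3"
    using assms(5) by (simp add: h_def)
  \<comment> \<open>For \<open>n \<ge> 2 * h\<close> the bound's left side \<open>n + 1 - h\<close>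
    is at least \<open>n / 2\<close>, which doubles the factor \<open>4\<close> to
    \<open>8\<close>.\<close>
  define k where "k = 1 / (8 * (real h)\<^sup>2)"
  have "ereal (k * \<bar>real n\<bar>) \<le> ereal_of_enat (one_round_bandwidth (MemDetect H) n)"
    if n: "n \<ge> 2 * h" for n
  proof -
    have bound: "k * real n \<le> real B" if "has_bandwidth B A" "one_round_solves n (MemDetect H) A" for B A
    proof -
      have "Suc n - h \<le> 4 * h\<^sup>2 * B"
        using MemDetect_multipartite_bandwidth[OF assms that] n by (simp add: h_def)
      then have "n \<le> 8 * h\<^sup>2 * B"
        using n by simp
      then have "real n \<le> 8 * (real h)\<^sup>2 * real B"
        by (metis (mono_tags) of_nat_le_iff of_nat_mult of_nat_numeral of_nat_power)
      then show ?thesis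
        using h by (simp add: k_def field_simps)
    qed
    show ?thesis
    proof (cases "one_round_bandwidth (MemDetect H) n")
      case (enat B)
      let ?Bs = "{enat B |B. \<exists>A. has_bandwidth B A \<and> one_round_solves n (MemDetect H) A}"
      have "?Bs \<noteq> {}"
        using enat by (auto simp: one_round_bandwidth_def Inf_enat_def split: if_splits)
      \<comment> \<open>A finite infimum is attained by some algorithm, since \<open>enat\<close> is
        well-ordered; the infinite case is trivial.\<close>
      then have "enat B \<in> ?Bs"
        using enat unfolding one_round_bandwidth_def by (metis (no_types, lifting) wellorder_InfI ex_in_conv)
      then show ?thesis
        using bound enat by auto
    qed simp
  qed
  moreover have "k > 0"
    using h by (simp add: k_def)
  ultimately show ?thesis
    unfolding enat_bigomega_def eventually_sequentially by blast
qed

end
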